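(* Let $n\in\mathbb{N}$, let $x_1,\dots,x_{n+1}$ be distinct commuting indeterminates over $\mathbb{C}$, and let $\mathcal{S}_{x_1,\dots,x_{n+1}}$ be the symmetric algebra in $\{x_1,\dots,x_n,x_{n+1}\}$. Let $j\in\{1,\dots,n+1\}$, and let $\Phi:\mathcal{S}_{x_1,\dots,x_{j-1},x_{j+1},\dots,x_{n+1}}\to\mathcal{S}_{x_1,\dots,x_{n+1}}$ be the algebra-monomorphism determined by $$\Phi\left(\varepsilon_k^{x_1,\dots,x_{j-1},x_{j+1},\dots,x_{n+1}}\right)=\varepsilon_k^{x_1,\dots,x_{j-1},x_{j+1},\dots,x_{n+1}}+\varepsilon_{k-1}^{x_1,\dots,x_{j-1},x_{j+1},\dots,x_{n+1}}\,x_j,\qquad k=1,\dots,n.$$ Then there is an algebra isomorphism $$\mathcal{S}_{x_1,\dots,x_{n+1}}\;\cong\;\Phi\left(\mathcal{S}_{x_1,\dots,x_{j-1},x_{j+1},\dots,x_{n+1}}\right)\oplus\mathbb{C}\left[\varepsilon_n^{x_1,\dots,x_{j-1},x_{j+1},\dots,x_{n+1}}\,\varepsilon_1^{x_j}\right],$$ where $\oplus$ means the (pure-algebraic) direct product of algebras.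
   Context: For distinct commuting indeterminates $z_1,\dots,z_m$, $\mathcal{S}_{z_1,\dots,z_m}$ is the subalgebra of $\mathbb{C}[z_1,\dots,z_m]$ consisting of symmetric polynomials. $\varepsilon_k^{z_1,\dots,z_m}$ is the $k$-th elementary symmetric polynomial in $z_1,\dots,z_m$ for $1\le k\le m$, with $\varepsilon_0^{z_1,\dots,z_m}=1$; in particular $\varepsilon_1^{x_j}=x_j$. By the fundamental theorem of symmetric functions, $\mathcal{S}_{z_1,\dots,z_m}$ is generated by $\varepsilon_1^{z_1,\dots,z_m},\dots,\varepsilon_m^{z_1,\dots,z_m}$; $\Phi$ is the linear multiplicative map fixing constants and extending the given values on the generators of its domain. For a polynomial $p$, $\mathbb{C}[p]$ denotes the algebra generated by $p$.
   Formalization: The direct product ⊕ of algebras is taken to be the tensor product over ℂ; with the componentwise direct product the claim fails for every n and j, since the symmetric polynomials form an integral domain while a product of two nonzero algebras has zero divisors. *)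

theory Defs
  imports
    Complex_Main
    "HOL-Library.Poly_Mapping"
    "HOL-Combinatorics.Permutations"
    "HOL-Algebra.QuotRing"
    "HOL-Algebra.Module"
begin

section \<open>Polynomials over the complex numbers\<close>

text \<open>
  Polynomials in indeterminates indexed by \<open>nat\<close>: a monomial is a finitely supported exponent
  vector, a polynomial a finitely supported family of coefficients. The ring operations are
  those of \<open>HOL-Library.Poly_Mapping\<close>.
\<close>

type_synonym cpoly = "(nat \<Rightarrow>\<^sub>0 nat) \<Rightarrow>\<^sub>0 complex"

definition Const :: "complex \<Rightarrow> cpoly" where
  "Const c = Poly_Mapping.single 0 c"

definition Var :: "nat \<Rightarrow> cpoly" where
  "Var i = Poly_Mapping.single (Poly_Mapping.single i 1) 1"

definition polys_in :: "nat set \<Rightarrow> cpoly set" where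
  "polys_in I = {p. \<forall>m \<in> Poly_Mapping.keys p. Poly_Mapping.keys m \<subseteq> I}"

text \<open>
  \<open>Poly_Mapping.map_key \<pi> m\<close> is the exponent vector \<open>m \<circ> \<pi>\<close>, so the condition says that every
  permutation of the indeterminates indexed by \<open>I\<close> leaves \<open>p\<close> unchanged.
\<close>

definition symmetric_polys :: "nat set \<Rightarrow> cpoly set" where
  "symmetric_polys I = {p \<in> polys_in I. \<forall>\<pi>. \<pi> permutes I \<longrightarrow>
     (\<forall>m. Poly_Mapping.lookup p (Poly_Mapping.map_key \<pi> m) = Poly_Mapping.lookup p m)}"

definition elem_sym :: "nat set \<Rightarrow> nat \<Rightarrow> cpoly" where
  "elem_sym I k = (\<Sum>X \<in> {X. X \<subseteq> I \<and> card X = k}. \<Prod>i\<in>X. Var i)"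

section \<open>Algebras over the complex numbers\<close>

definition poly_algebra :: "cpoly set \<Rightarrow> (complex, cpoly) module" where
  "poly_algebra A = \<lparr>carrier = A, monoid.mult = (*), one = 1, zero = 0, add = (+),
     smult = (\<lambda>c p. Const c * p)\<rparr>"

definition poly_subalgebra :: "cpoly set \<Rightarrow> bool" where
  "poly_subalgebra A \<longleftrightarrow> range Const \<subseteq> A \<and> (\<forall>p\<in>A. \<forall>q\<in>A. p + q \<in> A \<and> p * q \<in> A)"

definition sym_algebra :: "nat set \<Rightarrow> (complex, cpoly) module" where
  "sym_algebra I = poly_algebra (symmetric_polys I)"

definition algebra_generated_by :: "cpoly \<Rightarrow> (complex, cpoly) module" where
  "algebra_generated_by p = poly_algebra (poly_subalgebra hull {p})"

definition algebra_hom :: "(complex, 'a) module \<Rightarrow> (complex, 'b) module \<Rightarrow> ('a \<Rightarrow> 'b) set" where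
  "algebra_hom A B = {h \<in> ring_hom A B. \<forall>c. \<forall>x \<in> carrier A. h (c \<odot>\<^bsub>A\<^esub> x) = c \<odot>\<^bsub>B\<^esub> h x}"

definition algebra_mono :: "(complex, 'a) module \<Rightarrow> (complex, 'b) module \<Rightarrow> ('a \<Rightarrow> 'b) set" where
  "algebra_mono A B = {h \<in> algebra_hom A B. inj_on h (carrier A)}"

definition algebra_isomorphic :: "(complex, 'a) module \<Rightarrow> (complex, 'b) module \<Rightarrow> bool"
    (infix \<open>\<cong>\<^sub>a\<^sub>l\<^sub>g\<close> 50) where
  "A \<cong>\<^sub>a\<^sub>l\<^sub>g B \<longleftrightarrow> (\<exists>h \<in> algebra_hom A B. bij_betw h (carrier A) (carrier B))"

section \<open>The direct product of algebras\<close>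

text \<open>
  ``Direct product of algebras'' is understood in the classical sense of Wedderburn and Albert,
  i.e. as the (purely algebraic) tensor product over the ground field, without completion.
  The componentwise product of two unital algebras always has zero divisors, hence is never
  isomorphic to an algebra of polynomials.

  The construction is the usual one: \<open>formal_tensors A B\<close> is the vector space with basis
  \<open>carrier A \<times> carrier B\<close>, where the product of the basis vectors \<open>(a, b)\<close> and \<open>(a', b')\<close> is
  \<open>(a a', b b')\<close>; it is divided by the bilinearity relations. The linear span of these relations
  is already an ideal, so it is the same as the ideal they generate.
\<close>

definition formal_tensors ::
  "(complex, 'a) module \<Rightarrow> (complex, 'b) module \<Rightarrow> ('a \<times> 'b \<Rightarrow>\<^sub>0 complex) ring" where
  "formal_tensors A B =
     \<lparr>carrier = {f. Poly_Mapping.keys f \<subseteq> carrier A \<times> carrier B},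
      monoid.mult = (\<lambda>f g. \<Sum>u \<in> Poly_Mapping.keys f. \<Sum>v \<in> Poly_Mapping.keys g.
        Poly_Mapping.single (fst u \<otimes>\<^bsub>A\<^esub> fst v, snd u \<otimes>\<^bsub>B\<^esub> snd v)
          (Poly_Mapping.lookup f u * Poly_Mapping.lookup g v)),
      one = Poly_Mapping.single (\<one>\<^bsub>A\<^esub>, \<one>\<^bsub>B\<^esub>) 1, zero = 0, add = (+)\<rparr>"

definition bilinearity_relations ::
  "(complex, 'a) module \<Rightarrow> (complex, 'b) module \<Rightarrow> ('a \<times> 'b \<Rightarrow>\<^sub>0 complex) set" where
  "bilinearity_relations A B =
     {Poly_Mapping.single (a \<oplus>\<^bsub>A\<^esub> a', b) 1
        - Poly_Mapping.single (a, b) 1 - Poly_Mapping.single (a', b) 1 | a a' b.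
        a \<in> carrier A \<and> a' \<in> carrier A \<and> b \<in> carrier B} \<union>
     {Poly_Mapping.single (a, b \<oplus>\<^bsub>B\<^esub> b') 1
        - Poly_Mapping.single (a, b) 1 - Poly_Mapping.single (a, b') 1 | a b b'.
        a \<in> carrier A \<and> b \<in> carrier B \<and> b' \<in> carrier B} \<union>
     {Poly_Mapping.single (c \<odot>\<^bsub>A\<^esub> a, b) 1 - Poly_Mapping.single (a, b) c | c a b.
        a \<in> carrier A \<and> b \<in> carrier B} \<union>
     {Poly_Mapping.single (a, c \<odot>\<^bsub>B\<^esub> b) 1 - Poly_Mapping.single (a, b) c | c a b.
        a \<in> carrier A \<and> b \<in> carrier B}"

definition algebra_direct_product ::
  "(complex, 'a) module \<Rightarrow> (complex, 'b) module \<Rightarrow> (complex, ('a \<times> 'b \<Rightarrow>\<^sub>0 complex) set) module"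
    (infixr \<open>\<otimes>\<^sub>a\<^sub>l\<^sub>g\<close> 70) where
  "A \<otimes>\<^sub>a\<^sub>l\<^sub>g B =
     (let F = formal_tensors A B; I = Idl\<^bsub>F\<^esub> (bilinearity_relations A B); Q = F Quot I in
      \<lparr>carrier = carrier Q, monoid.mult = monoid.mult Q, one = one Q, zero = zero Q, add = add Q,
       smult = (\<lambda>c X. \<Union>f\<in>X. I +>\<^bsub>F\<^esub> Poly_Mapping.map ((*) c) f)\<rparr>)"

end

theory Submission
  imports Defs "HOL-Computational_Algebra.Polynomial"
begin

text \<open>
  Write \<open>e\<^sub>k\<close> for the elementary symmetric polynomials in all \<open>n + 1\<close> variables. The map \<open>\<Phi>\<close>
  sends the \<open>k\<close>-th elementary symmetric polynomial without \<open>x\<^sub>j\<close> to \<open>e\<^sub>k\<close>, so setting \<open>x\<^sub>j = 0\<close>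
  is a left inverse of \<open>\<Phi>\<close>, while it annihilates \<open>e\<^sub>n\<^sub>+\<^sub>1\<close>, the product of all variables. Hence the
  powers of \<open>e\<^sub>n\<^sub>+\<^sub>1\<close> are linearly independent over the image of \<open>\<Phi>\<close>. By the fundamental theorem of
  symmetric polynomials they also span, so the symmetric polynomials are the polynomials in
  \<open>e\<^sub>n\<^sub>+\<^sub>1\<close> over the image of \<open>\<Phi>\<close>. Congruence modulo \<open>x\<^sub>j\<close> replaces the substitution \<open>x\<^sub>j = 0\<close>.
\<close>

section \<open>Finitely supported maps: decomposition into terms, induction, convolution\<close>

lemma poly_mapping_sum_single:
  "p = (\<Sum>m\<in>Poly_Mapping.keys p. Poly_Mapping.single m (Poly_Mapping.lookup p m))"
  by (rule poly_mapping_eqI) (auto simp: lookup_sum lookup_single when_def in_keys_iff)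

text \<open>A finitely supported map is the sum of its terms, so additive claims reduce to single
  terms. The bound \<open>K\<close> makes the rule usable inside a carrier; with
  \<open>subset_UNIV\<close> it is unrestricted.\<close>

lemma poly_mapping_add_induct [consumes 1, case_names zero single add]:
  fixes p :: "'a \<Rightarrow>\<^sub>0 'b::comm_monoid_add"
  assumes "Poly_Mapping.keys p \<subseteq> K"
    and "P 0"
    and "\<And>m c. m \<in> K \<Longrightarrow> P (Poly_Mapping.single m c)"
    and "\<And>p q. \<lbrakk>Poly_Mapping.keys p \<subseteq> K; Poly_Mapping.keys q \<subseteq> K; P p; P q\<rbrakk> \<Longrightarrow> P (p + q)"
  shows "P p"
proof -
  have "Poly_Mapping.keys (\<Sum>m\<in>S. Poly_Mapping.single m (f m)) \<subseteq> K \<and>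
      P (\<Sum>m\<in>S. Poly_Mapping.single m (f m))" if "finite S" "S \<subseteq> K" for S f
    using that
  proof (induction S rule: finite_induct)
    case (insert x S)
    have "Poly_Mapping.keys (Poly_Mapping.single x (f x)) \<subseteq> K"
      using insert by auto
    moreover have "Poly_Mapping.keys (\<Sum>m\<in>S. Poly_Mapping.single m (f m)) \<subseteq> K"
      "P (\<Sum>m\<in>S. Poly_Mapping.single m (f m))"
      using insert by auto
    moreover have "P (Poly_Mapping.single x (f x))"
      using insert assms(3) by auto
    ultimately show ?case
      using insert(1,2) assms(4) by (auto dest!: subsetD[OF keys_add])
  qed (use assms(2) in simp)
  with assms(1) poly_mapping_sum_single[of p] show ?thesis
    by (metis finite_keys)
qed

text \<open>Convolution over the finite key sets, a form in which both sums can be reindexed by a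
  permutation of the monomials.\<close>

lemma lookup_mult_sum:
  "Poly_Mapping.lookup (p * q) m = (\<Sum>a\<in>Poly_Mapping.keys p. \<Sum>b\<in>Poly_Mapping.keys q.
     (Poly_Mapping.lookup p a * Poly_Mapping.lookup q b when a + b = m))"
  by (subst (1) poly_mapping_sum_single[of p], subst (1) poly_mapping_sum_single[of q])
    (simp add: sum_product mult_single lookup_sum lookup_single)

section \<open>Divisibility by monomials\<close>

lemma lookup_monomial_mult:
  fixes p :: cpoly
  shows "Poly_Mapping.lookup (Poly_Mapping.single M 1 * p) (M + k) = Poly_Mapping.lookup p k"
  using subset_UNIV
proof (induction p rule: poly_mapping_add_induct)
  case (single m c)
  show ?case by (simp add: mult_single lookup_single when_def)
qed (simp_all add: distrib_left lookup_add)

lemma monomial_dvd_iff: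
  fixes p :: cpoly
  shows "Poly_Mapping.single M 1 dvd p \<longleftrightarrow> (\<forall>m\<in>Poly_Mapping.keys p. \<exists>k. m = M + k)"
proof
  assume "Poly_Mapping.single M 1 dvd p"
  then obtain r where "p = Poly_Mapping.single M 1 * r" by (elim dvdE)
  then show "\<forall>m\<in>Poly_Mapping.keys p. \<exists>k. m = M + k"
    using keys_mult[of "Poly_Mapping.single M 1" r] by auto
next
  assume *: "\<forall>m\<in>Poly_Mapping.keys p. \<exists>k. m = M + k"
  have "Poly_Mapping.single M (1::complex) dvd Poly_Mapping.single (M + k) c" for k c
    by (metis dvd_triv_left mult_1 mult_single)
  with * have "Poly_Mapping.single M 1 dvd
      (\<Sum>m\<in>Poly_Mapping.keys p. Poly_Mapping.single m (Poly_Mapping.lookup p m))"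
    by (intro dvd_sum) metis
  then show "Poly_Mapping.single M 1 dvd p"
    using poly_mapping_sum_single[of p] by simp
qed

definition squarefree_exponent :: "nat set \<Rightarrow> nat \<Rightarrow>\<^sub>0 nat" where
  "squarefree_exponent X = (\<Sum>i\<in>X. Poly_Mapping.single i 1)"

lemma lookup_squarefree_exponent:
  "finite X \<Longrightarrow> Poly_Mapping.lookup (squarefree_exponent X) i = (if i \<in> X then 1 else 0)"
  by (auto simp: squarefree_exponent_def lookup_sum lookup_single when_def)

lemma prod_Var: "(\<Prod>i\<in>X. Var i) = Poly_Mapping.single (squarefree_exponent X) 1"
  by (induction X rule: infinite_finite_induct)
    (auto simp: squarefree_exponent_def Var_def mult_single)

text \<open>Divisibility by a monomial can be tested on each monomial separately, and for a
  squarefree one only the supports matter.\<close>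

lemma prod_Var_dvd_iff:
  assumes "finite X"
  shows "(\<Prod>i\<in>X. Var i) dvd p \<longleftrightarrow> (\<forall>m\<in>Poly_Mapping.keys p. X \<subseteq> Poly_Mapping.keys m)"
proof -
  have "(\<exists>k. m = squarefree_exponent X + k) \<longleftrightarrow> X \<subseteq> Poly_Mapping.keys m" for m
  proof
    assume "X \<subseteq> Poly_Mapping.keys m"
    \<comment> \<open>Subtraction of exponents is truncated; it is exact here because
      \<open>m\<close> is at least 1 everywhere on \<open>X\<close>.\<close>
    then have "m = squarefree_exponent X + (m - squarefree_exponent X)"
      using assms
      by (intro poly_mapping_eqI)
        (auto simp: lookup_add lookup_minus lookup_squarefree_exponent in_keys_iff
          subset_iff Suc_le_eq)
    then show "\<exists>k. m = squarefree_exponent X + k" ..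
  qed (use assms in \<open>auto simp: in_keys_iff lookup_add lookup_squarefree_exponent\<close>)
  then show ?thesis
    by (simp add: prod_Var monomial_dvd_iff)
qed

lemma Var_dvd_iff: "Var j dvd p \<longleftrightarrow> (\<forall>m\<in>Poly_Mapping.keys p. j \<in> Poly_Mapping.keys m)"
  using prod_Var_dvd_iff[of "{j}" p] by simp

text \<open>Stands in for evaluation at x_j = 0: a polynomial free of x_j is determined by its class
  modulo x_j.\<close>

lemma Var_dvd_polys_in_eq_0:
  assumes "Var j dvd p" "p \<in> polys_in J" "j \<notin> J"
  shows "p = 0"
proof -
  have "m \<notin> Poly_Mapping.keys p" for m
    using assms by (auto simp: Var_dvd_iff polys_in_def)
  then show ?thesis
    by (metis equals0I keys_eq_empty)
qed

section \<open>Elementary symmetric polynomials\<close>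

text \<open>Distinct subsets give distinct squarefree monomials, so at most the summand with
  \<open>X = Poly_Mapping.keys m\<close> contributes. Symmetry and degree of \<open>elem_sym\<close>
  are both read off from this formula.\<close>

lemma lookup_elem_sym:
  assumes "finite I"
  shows "Poly_Mapping.lookup (elem_sym I k) m =
    (if Poly_Mapping.keys m \<subseteq> I \<and> card (Poly_Mapping.keys m) = k \<and>
      (\<forall>i. Poly_Mapping.lookup m i \<le> 1) then 1 else 0)"
proof -
  have *: "squarefree_exponent X = m \<longleftrightarrow>
      X = Poly_Mapping.keys m \<and> (\<forall>i. Poly_Mapping.lookup m i \<le> 1)" if "X \<subseteq> I" for X
  proof
    assume "squarefree_exponent X = m"
    then show "X = Poly_Mapping.keys m \<and> (\<forall>i. Poly_Mapping.lookup m i \<le> 1)"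
      using finite_subset[OF that assms]
      by (auto simp: in_keys_iff lookup_squarefree_exponent split: if_splits)
  next
    assume r: "X = Poly_Mapping.keys m \<and> (\<forall>i. Poly_Mapping.lookup m i \<le> 1)"
    show "squarefree_exponent X = m"
    proof (rule poly_mapping_eqI)
      fix i
      from r have "Poly_Mapping.lookup m i = 0 \<or> Poly_Mapping.lookup m i = 1"
        by (metis One_nat_def le_Suc_eq le_zero_eq)
      with r show "Poly_Mapping.lookup (squarefree_exponent X) i = Poly_Mapping.lookup m i"
        using finite_subset[OF that assms] by (auto simp: in_keys_iff lookup_squarefree_exponent)
    qed
  qed
  have "Poly_Mapping.lookup (elem_sym I k) m =
      (\<Sum>X | X \<subseteq> I \<and> card X = k. 1 when squarefree_exponent X = m)"
    by (simp add: elem_sym_def prod_Var lookup_sum lookup_single)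
  also have "\<dots> = (\<Sum>X | X \<subseteq> I \<and> card X = k.
      if X = Poly_Mapping.keys m then (if \<forall>i. Poly_Mapping.lookup m i \<le> 1 then 1 else 0) else 0)"
    by (intro sum.cong) (auto simp: * when_def)
  finally show ?thesis
    using assms by (auto simp: sum.delta')
qed

lemma elem_sym_0: "finite I \<Longrightarrow> elem_sym I 0 = 1"
proof -
  assume "finite I"
  then have "{X. X \<subseteq> I \<and> card X = 0} = {{}}"
    by (auto dest: finite_subset)
  then show ?thesis by (simp add: elem_sym_def)
qed

lemma elem_sym_eq_0:
  assumes "finite I" "card I < k"
  shows "elem_sym I k = 0"
proof -
  have "{X. X \<subseteq> I \<and> card X = k} = {}"
    using assms card_mono leD by blast
  then show ?thesis by (simp only: elem_sym_def sum.empty)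
qed

lemma elem_sym_card:
  assumes "finite I"
  shows "elem_sym I (card I) = (\<Prod>i\<in>I. Var i)"
proof -
  have "{X. X \<subseteq> I \<and> card X = card I} = {I}"
    using assms by (auto dest: card_subset_eq)
  then show ?thesis by (simp add: elem_sym_def)
qed

text \<open>The \<open>k\<close>-subsets of \<open>I\<close> are split by whether they contain
  \<open>j\<close>. The right-hand side is the value prescribed for \<Phi>, which is thereby
  recognised as \<open>elem_sym I k\<close>.\<close>

lemma elem_sym_recursion:
  assumes "finite I" "j \<in> I" "1 \<le> k"
  shows "elem_sym I k = elem_sym (I - {j}) k + elem_sym (I - {j}) (k - 1) * Var j"
proof -
  let ?A = "\<lambda>k. {X. X \<subseteq> I - {j} \<and> card X = k}"
  have fin: "finite X" if "X \<subseteq> I - {j}" for X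
    using that assms(1) by (meson finite_Diff finite_subset)
  have split: "{X. X \<subseteq> I \<and> card X = k} = ?A k \<union> insert j ` ?A (k - 1)"
  proof (intro equalityI subsetI)
    fix X assume X: "X \<in> {X. X \<subseteq> I \<and> card X = k}"
    show "X \<in> ?A k \<union> insert j ` ?A (k - 1)"
    proof (cases "j \<in> X")
      case True
      then have "X = insert j (X - {j})" "X - {j} \<in> ?A (k - 1)"
        using X by auto
      then show ?thesis by blast
    qed (use X in auto)
  next
    fix X assume "X \<in> ?A k \<union> insert j ` ?A (k - 1)"
    then show "X \<in> {X. X \<subseteq> I \<and> card X = k}"
    proof
      assume "X \<in> insert j ` ?A (k - 1)"
      then obtain Y where Y: "X = insert j Y" "Y \<subseteq> I - {j}" "card Y = k - 1" by auto
      with fin[of Y] assms show ?thesis by (auto simp: card_insert_if)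
    qed auto
  qed
  have inj: "inj_on (insert j) (?A (k - 1))"
    by (auto simp: inj_on_def)
  have "(\<Sum>X\<in>insert j ` ?A (k - 1). \<Prod>i\<in>X. Var i) = (\<Sum>X\<in>?A (k - 1). \<Prod>i\<in>insert j X. Var i)"
    by (rule sum.reindex[OF inj, unfolded comp_def])
  also have "\<dots> = (\<Sum>X\<in>?A (k - 1). (\<Prod>i\<in>X. Var i) * Var j)"
    by (intro sum.cong refl, subst prod.insert) (use fin in \<open>auto simp: mult.commute\<close>)
  finally have "(\<Sum>X\<in>insert j ` ?A (k - 1). \<Prod>i\<in>X. Var i) = elem_sym (I - {j}) (k - 1) * Var j"
    by (simp add: elem_sym_def sum_distrib_right)
  moreover have "elem_sym I k = (\<Sum>X\<in>?A k. \<Prod>i\<in>X. Var i) + (\<Sum>X\<in>insert j ` ?A (k - 1). \<Prod>i\<in>X. Var i)"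
    unfolding elem_sym_def split using assms(1) by (intro sum.union_disjoint) auto
  ultimately show ?thesis
    by (simp add: elem_sym_def)
qed

lemma elem_sym_cong_Var:
  assumes "finite I" "j \<in> I"
  shows "Var j dvd elem_sym I k - elem_sym (I - {j}) k"
  using elem_sym_recursion[OF assms, of k] assms(1) by (cases k) (auto simp: elem_sym_0)

section \<open>Symmetric polynomials\<close>

lemma Const_in_symmetric_polys: "Const c \<in> symmetric_polys I"
proof -
  have "Poly_Mapping.map_key \<pi> m = 0 \<longleftrightarrow> m = 0" if "\<pi> permutes I" for \<pi> and m :: "nat \<Rightarrow>\<^sub>0 nat"
    using that permutes_surj[OF that] permutes_inj[OF that]
    by (metis (no_types, lifting) keys_eq_empty keys_map_key surj_image_vimage_eq image_empty
        vimage_empty)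
  then show ?thesis
    by (auto simp: symmetric_polys_def polys_in_def Const_def lookup_single when_def
        split: if_splits)
qed

lemma symmetric_polys_add:
  assumes "p \<in> symmetric_polys I" "q \<in> symmetric_polys I"
  shows "p + q \<in> symmetric_polys I"
  using assms keys_add[of p q]
  by (fastforce simp: symmetric_polys_def polys_in_def lookup_add)

lemma polys_in_mult:
  assumes "p \<in> polys_in I" "q \<in> polys_in I"
  shows "p * q \<in> polys_in I"
proof -
  have "Poly_Mapping.keys m \<subseteq> I" if m: "m \<in> Poly_Mapping.keys (p * q)" for m
  proof -
    obtain a b where "m = a + b" "a \<in> Poly_Mapping.keys p" "b \<in> Poly_Mapping.keys q"
      using subsetD[OF keys_mult m] by auto
    then show ?thesis
      using assms keys_add[of a b] unfolding polys_in_def by blast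
  qed
  then show ?thesis by (simp add: polys_in_def)
qed

text \<open>The inverse is \<open>map_key\<close> of the inverse permutation.\<close>

lemma bij_map_key:
  assumes "\<pi> permutes I"
  shows "bij (Poly_Mapping.map_key \<pi> :: (nat \<Rightarrow>\<^sub>0 nat) \<Rightarrow> _)"
proof (rule o_bij)
  have inj: "inj \<pi>" "inj (inv_into UNIV \<pi>)"
    using assms by (auto intro: permutes_inj permutes_inv)
  have id: "Poly_Mapping.map_key id m = m" for m :: "nat \<Rightarrow>\<^sub>0 nat"
    using map_key_id[of m] by (simp add: id_def)
  show "Poly_Mapping.map_key (inv_into UNIV \<pi>) \<circ> Poly_Mapping.map_key \<pi> = (id :: (nat \<Rightarrow>\<^sub>0 nat) \<Rightarrow> _)"
    using inj by (auto simp: fun_eq_iff map_key_compose permutes_inv_o[OF assms] id)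
  show "Poly_Mapping.map_key \<pi> \<circ> Poly_Mapping.map_key (inv_into UNIV \<pi>) = (id :: (nat \<Rightarrow>\<^sub>0 nat) \<Rightarrow> _)"
    using inj by (auto simp: fun_eq_iff map_key_compose permutes_inv_o[OF assms] id)
qed

text \<open>The action of a permutation on exponent vectors is an additive bijection that preserves
  the key set of each symmetric polynomial, so it reindexes both sums of the convolution.\<close>

lemma symmetric_polys_mult:
  assumes "p \<in> symmetric_polys I" "q \<in> symmetric_polys I"
  shows "p * q \<in> symmetric_polys I"
proof -
  have "Poly_Mapping.lookup (p * q) (Poly_Mapping.map_key \<pi> m) = Poly_Mapping.lookup (p * q) m"
    if \<pi>: "\<pi> permutes I" for \<pi> m
  proof -
    let ?h = "Poly_Mapping.map_key \<pi> :: (nat \<Rightarrow>\<^sub>0 nat) \<Rightarrow> _"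
    have inj: "inj \<pi>" using \<pi> by (rule permutes_inj)
    have bij: "bij ?h" using \<pi> by (rule bij_map_key)
    have keys: "bij_betw ?h (Poly_Mapping.keys r) (Poly_Mapping.keys r)"
      if "r \<in> symmetric_polys I" for r
    proof (rule bij_betw_subset[OF bij, of "Poly_Mapping.keys r"])
      have "Poly_Mapping.lookup r (?h a) = Poly_Mapping.lookup r a" for a
        using that \<pi> by (simp add: symmetric_polys_def)
      then have "?h a \<in> Poly_Mapping.keys r \<longleftrightarrow> a \<in> Poly_Mapping.keys r" for a
        by (simp add: in_keys_iff)
      then show "?h ` Poly_Mapping.keys r = Poly_Mapping.keys r"
        using bij by (metis bij_is_surj image_vimage_eq inf_top.right_neutral subsetI
            subset_antisym vimageI vimageE)
    qed simp
    have reindex: "(\<Sum>a\<in>Poly_Mapping.keys r. f (?h a)) = (\<Sum>a\<in>Poly_Mapping.keys r. f a)"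
      if "r \<in> symmetric_polys I" for r and f :: "_ \<Rightarrow> complex"
      using keys[OF that] by (rule sum.reindex_bij_betw)
    have "Poly_Mapping.lookup (p * q) (?h m) = (\<Sum>a\<in>Poly_Mapping.keys p. \<Sum>b\<in>Poly_Mapping.keys q.
        (Poly_Mapping.lookup p (?h a) * Poly_Mapping.lookup q (?h b) when ?h a + ?h b = ?h m))"
      unfolding lookup_mult_sum
      by (subst reindex[OF assms(1), symmetric], subst reindex[OF assms(2), symmetric]) rule
    also have "\<dots> = Poly_Mapping.lookup (p * q) m"
      unfolding lookup_mult_sum
      using assms \<pi> bij by (simp add: symmetric_polys_def flip: map_key_plus[OF inj])
        (simp add: bij_is_inj inj_eq)
    finally show ?thesis .
  qed
  with assms show ?thesis
    by (auto simp: symmetric_polys_def polys_in_mult)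
qed

lemma elem_sym_in_symmetric_polys:
  assumes "finite I"
  shows "elem_sym I k \<in> symmetric_polys I"
proof -
  have "Poly_Mapping.lookup (elem_sym I k) (Poly_Mapping.map_key \<pi> m) =
      Poly_Mapping.lookup (elem_sym I k) m" if \<pi>: "\<pi> permutes I" for \<pi> m
  proof -
    have inj: "inj \<pi>" and bij: "bij \<pi>"
      using \<pi> by (rule permutes_inj, rule permutes_bij)
    have "\<pi> -` Poly_Mapping.keys m \<subseteq> I \<longleftrightarrow> Poly_Mapping.keys m \<subseteq> I"
      using permutes_in_image[OF \<pi>] bij
      by (auto simp: subset_iff) (metis \<pi> permutes_inverses(1))
    moreover have "card (\<pi> -` Poly_Mapping.keys m) = card (Poly_Mapping.keys m)"
      using bij by (simp add: bij_is_inj bij_is_surj card_vimage_inj)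
    moreover have "Poly_Mapping.lookup (Poly_Mapping.map_key \<pi> m) i = Poly_Mapping.lookup m (\<pi> i)"
      for i
      by (simp add: map_key.rep_eq[OF inj])
    moreover have "(\<forall>i. Poly_Mapping.lookup m (\<pi> i) \<le> 1) \<longleftrightarrow> (\<forall>i. Poly_Mapping.lookup m i \<le> 1)"
      by (metis \<pi> permutes_inverses(1))
    ultimately show ?thesis
      using assms by (simp add: lookup_elem_sym keys_map_key[OF inj])
  qed
  with assms show ?thesis
    by (auto simp: symmetric_polys_def polys_in_def)
      (auto simp: in_keys_iff[of _ "elem_sym I k"] lookup_elem_sym split: if_splits)
qed

section \<open>The fundamental theorem of symmetric polynomials\<close>

lemma Const_simps:
  "Const 0 = 0" "Const 1 = 1" "Const c + Const d = Const (c + d)"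
  "Const c * Const d = Const (c * d)"
  by (simp_all add: Const_def single_add mult_single)

lemma symmetric_polys_diff:
  assumes "p \<in> symmetric_polys I" "q \<in> symmetric_polys I"
  shows "p - q \<in> symmetric_polys I"
proof -
  have "p - q = p + Const (-1) * q"
    by (simp add: Const_def single_uminus)
  then show ?thesis
    using assms by (metis Const_in_symmetric_polys symmetric_polys_add symmetric_polys_mult)
qed

section \<open>Setting one variable to zero, and dividing by the product of all variables\<close>

lemma symmetric_polys_restrict:
  assumes "p \<in> symmetric_polys I"
  obtains q where "q \<in> symmetric_polys (I - {j})" "Var j dvd p - q"
    "Poly_Mapping.keys q \<subseteq> Poly_Mapping.keys p"
proof -
  \<comment> \<open>This is \<open>p\<close> at x_j = 0: only the monomials free of x_j are
    kept.\<close>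
  define q where "q = (\<Sum>m | m \<in> Poly_Mapping.keys p \<and> j \<notin> Poly_Mapping.keys m.
    Poly_Mapping.single m (Poly_Mapping.lookup p m))"
  have q: "Poly_Mapping.lookup q m = (Poly_Mapping.lookup p m when j \<notin> Poly_Mapping.keys m)" for m
    by (auto simp: q_def lookup_sum lookup_single when_def in_keys_iff sum.delta)
  have keys_q: "m \<in> Poly_Mapping.keys q \<longleftrightarrow> m \<in> Poly_Mapping.keys p \<and> j \<notin> Poly_Mapping.keys m" for m
    by (auto simp: in_keys_iff[of m] q)
  have "Poly_Mapping.lookup q (Poly_Mapping.map_key \<pi> m) = Poly_Mapping.lookup q m"
    if \<pi>: "\<pi> permutes I - {j}" for \<pi> m
  proof -
    \<comment> \<open>As \<open>j\<close> is fixed, permuting a monomial never moves it between the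
      kept and the discarded ones.\<close>
    have "\<pi> j = j"
      using \<pi> by (simp add: permutes_not_in)
    then have "j \<in> Poly_Mapping.keys (Poly_Mapping.map_key \<pi> m) \<longleftrightarrow> j \<in> Poly_Mapping.keys m"
      by (simp add: keys_map_key[OF permutes_inj[OF \<pi>]])
    moreover have "\<pi> permutes I"
      using \<pi> by (rule permutes_subset) auto
    ultimately show ?thesis
      using assms by (simp add: q symmetric_polys_def)
  qed
  moreover have "q \<in> polys_in (I - {j})"
    using assms by (auto simp: polys_in_def symmetric_polys_def keys_q)
  moreover have "Var j dvd p - q"
    by (auto simp: Var_dvd_iff in_keys_iff[of _ "p - q"] lookup_minus q when_def split: if_splits)
  ultimately show thesis
    using that[of q] keys_q by (auto simp: symmetric_polys_def)
qed

text \<open>The transposition of \<open>i\<close> and \<open>j\<close> turns divisibility by x_j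
  into divisibility by x_i, for every \<open>i\<close> in \<open>I\<close>.\<close>

lemma symmetric_polys_Var_dvd:
  assumes "p \<in> symmetric_polys I" "finite I" "j \<in> I" "Var j dvd p"
  shows "(\<Prod>i\<in>I. Var i) dvd p"
  unfolding prod_Var_dvd_iff[OF assms(2)]
proof (intro ballI subsetI)
  fix m i assume m: "m \<in> Poly_Mapping.keys p" and i: "i \<in> I"
  let ?\<pi> = "transpose i j"
  have \<pi>: "?\<pi> permutes I"
    using i assms(3) by (rule permutes_swap_id)
  have "Poly_Mapping.lookup p (Poly_Mapping.map_key ?\<pi> m) = Poly_Mapping.lookup p m"
    using assms(1) \<pi> by (simp add: symmetric_polys_def)
  then have "Poly_Mapping.map_key ?\<pi> m \<in> Poly_Mapping.keys p"
    using m by (simp add: in_keys_iff)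
  with assms(4) show "i \<in> Poly_Mapping.keys m"
    by (auto simp: Var_dvd_iff keys_map_key)
qed

text \<open>Division by the product shifts all exponents by a vector that every permutation of
  \<open>I\<close> fixes, so the quotient inherits the symmetry. The last conclusion records the
  drop in degree.\<close>

lemma symmetric_polys_divide:
  assumes "p \<in> symmetric_polys I" "finite I" "(\<Prod>i\<in>I. Var i) dvd p"
  obtains r where "r \<in> symmetric_polys I" "p = (\<Prod>i\<in>I. Var i) * r"
    "\<And>m. m \<in> Poly_Mapping.keys r \<Longrightarrow> squarefree_exponent I + m \<in> Poly_Mapping.keys p"
proof -
  let ?M = "squarefree_exponent I"
  obtain r where r: "p = (\<Prod>i\<in>I. Var i) * r"
    using assms(3) by (rule dvdE)
  then have lookup_r: "Poly_Mapping.lookup r m = Poly_Mapping.lookup p (?M + m)" for m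
    by (simp add: prod_Var lookup_monomial_mult)
  then have keys_r: "m \<in> Poly_Mapping.keys r \<longleftrightarrow> ?M + m \<in> Poly_Mapping.keys p" for m
    by (simp add: in_keys_iff)
  have "Poly_Mapping.lookup r (Poly_Mapping.map_key \<pi> m) = Poly_Mapping.lookup r m"
    if \<pi>: "\<pi> permutes I" for \<pi> m
  proof -
    note inj = permutes_inj[OF \<pi>]
    have "Poly_Mapping.map_key \<pi> ?M = ?M"
      using assms(2) permutes_in_image[OF \<pi>]
      by (intro poly_mapping_eqI) (simp add: map_key.rep_eq[OF inj] lookup_squarefree_exponent)
    then show ?thesis
      using assms(1) \<pi> unfolding lookup_r symmetric_polys_def
      by (metis (mono_tags, lifting) map_key_plus[OF inj] mem_Collect_eq)
  qed
  moreover have "r \<in> polys_in I"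
    unfolding polys_in_def
  proof (intro CollectI ballI)
    fix m assume "m \<in> Poly_Mapping.keys r"
    then have "Poly_Mapping.keys (?M + m) \<subseteq> I"
      using assms(1) by (auto simp: keys_r symmetric_polys_def polys_in_def)
    moreover have "Poly_Mapping.keys m \<subseteq> Poly_Mapping.keys (?M + m)"
      by (auto simp: in_keys_iff lookup_add)
    ultimately show "Poly_Mapping.keys m \<subseteq> I" by blast
  qed
  ultimately show thesis
    using that[of r] r keys_r by (auto simp: symmetric_polys_def)
qed

text \<open>
  \<open>elem_sym_poly I d p\<close>: \<open>p\<close> is a polynomial in the \<open>elem_sym I k\<close> whose weighted degree,
  with weight \<open>k\<close> for \<open>elem_sym I k\<close>, is at most \<open>d\<close>.
\<close>

inductive elem_sym_poly :: "nat set \<Rightarrow> nat \<Rightarrow> cpoly \<Rightarrow> bool" for I where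
  Const: "elem_sym_poly I d (Const c)"
| add: "elem_sym_poly I d p \<Longrightarrow> elem_sym_poly I d q \<Longrightarrow> elem_sym_poly I d (p + q)"
| mult: "elem_sym_poly I d p \<Longrightarrow> elem_sym_poly I (d + k) (p * elem_sym I k)"

lemma elem_sym_poly_symmetric:
  assumes "elem_sym_poly I d p" "finite I"
  shows "p \<in> symmetric_polys I"
  using assms
  by induction (auto intro: Const_in_symmetric_polys symmetric_polys_add symmetric_polys_mult
      elem_sym_in_symmetric_polys)

text \<open>Bounds the degree of a lift, so that subtracting it from a polynomial of degree at most
  \<open>d\<close> does not raise this bound.\<close>

lemma elem_sym_poly_degree:
  assumes "elem_sym_poly I d p" "finite I" "m \<in> Poly_Mapping.keys p"
  shows "(\<Sum>i\<in>I. Poly_Mapping.lookup m i) \<le> d"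
  using assms
proof (induction arbitrary: m)
  case (Const d c)
  then show ?case by (simp add: Const_def split: if_splits)
next
  case (add d p q)
  then show ?case using subsetD[OF keys_add, of m p q] by auto
next
  case (mult d p k)
  from subsetD[OF keys_mult mult.prems(2)] obtain a b
    where m: "m = a + b" and a: "a \<in> Poly_Mapping.keys p"
      and b: "b \<in> Poly_Mapping.keys (elem_sym I k)"
    by auto
  \<comment> \<open>The exponents in \<open>b\<close> are at most 1, so its degree is bounded by the
    number of its variables, which is \<open>k\<close>.\<close>
  have "(\<Sum>i\<in>I. Poly_Mapping.lookup b i) \<le> (\<Sum>i\<in>I. if i \<in> Poly_Mapping.keys b then 1 else 0)"
    using b mult.prems(1)
    by (intro sum_mono) (auto simp: in_keys_iff[of _ "elem_sym I k"] in_keys_iff[of _ b]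
        lookup_elem_sym split: if_splits)
  also have "\<dots> = card (I \<inter> Poly_Mapping.keys b)"
    using mult.prems(1) by (simp add: sum.If_cases)
  also have "I \<inter> Poly_Mapping.keys b = Poly_Mapping.keys b"
    using b mult.prems(1)
    by (auto simp: in_keys_iff[of _ "elem_sym I k"] lookup_elem_sym split: if_splits)
  also have "card (Poly_Mapping.keys b) = k"
    using b mult.prems(1)
    by (auto simp: in_keys_iff[of _ "elem_sym I k"] lookup_elem_sym split: if_splits)
  finally show ?case
    using mult.IH[OF mult.prems(1) a] by (simp add: m lookup_add sum.distrib)
qed

text \<open>In the expression for \<open>q\<close>, each \<open>elem_sym (I - {j}) k\<close> is
  replaced by \<open>elem_sym I k\<close>. The weights stay the same, and the two agree modulo
  x_j.\<close>

lemma elem_sym_poly_lift: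
  assumes "elem_sym_poly (I - {j}) d q" "finite I" "j \<in> I"
  shows "\<exists>Q. elem_sym_poly I d Q \<and> Var j dvd Q - q"
  using assms
proof induction
  case (Const d c)
  show ?case by (intro exI[of _ "Const c"]) (simp add: elem_sym_poly.Const)
next
  case (add d p q)
  then obtain P Q where "elem_sym_poly I d P" "Var j dvd P - p"
      "elem_sym_poly I d Q" "Var j dvd Q - q"
    by blast
  moreover from this have "Var j dvd (P + Q) - (p + q)"
    using dvd_add[of "Var j" "P - p" "Q - q"] by (simp add: algebra_simps)
  ultimately show ?case
    using elem_sym_poly.add by blast
next
  case (mult d p k)
  then obtain P where P: "elem_sym_poly I d P" "Var j dvd P - p"
    by blast
  have "Var j dvd (P - p) * elem_sym I k + p * (elem_sym I k - elem_sym (I - {j}) k)"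
    using P(2) elem_sym_cong_Var[OF mult.prems] by (intro dvd_add dvd_mult dvd_mult2)
  also have "\<dots> = P * elem_sym I k - p * elem_sym (I - {j}) k"
    by (simp add: algebra_simps)
  finally show ?case
    using elem_sym_poly.mult[OF P(1)] by blast
qed

text \<open>
  Subtracting a lift of \<open>p\<close> at \<open>x\<^sub>j = 0\<close> from \<open>p\<close> leaves a symmetric polynomial divisible by
  \<open>x\<^sub>j\<close>, hence by the product of all variables.
\<close>

lemma elem_sym_poly_if_symmetric:
  assumes "finite I" "p \<in> symmetric_polys I"
    and "\<And>m. m \<in> Poly_Mapping.keys p \<Longrightarrow> (\<Sum>i\<in>I. Poly_Mapping.lookup m i) \<le> d"
  shows "elem_sym_poly I d p"
  using assms
proof (induction I arbitrary: p d rule: finite_induct)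
  case empty
  then have "Poly_Mapping.keys p \<subseteq> {0}"
    by (auto simp: symmetric_polys_def polys_in_def)
  then have "p = Const (Poly_Mapping.lookup p 0)"
    by (intro poly_mapping_eqI) (auto simp: Const_def lookup_single when_def in_keys_iff)
  then show ?case
    by (metis elem_sym_poly.Const)
next
  case (insert j J)
  let ?I = "insert j J"
  let ?M = "squarefree_exponent ?I"
  have J: "?I - {j} = J" and fin: "finite ?I"
    using insert.hyps by auto
  have deg_M: "(\<Sum>i\<in>?I. Poly_Mapping.lookup (?M + m) i) =
      card ?I + (\<Sum>i\<in>?I. Poly_Mapping.lookup m i)" for m
  proof -
    have "(\<Sum>i\<in>?I. Poly_Mapping.lookup ?M i) = (\<Sum>i\<in>?I. 1)"
      using fin by (intro sum.cong) (auto simp: lookup_squarefree_exponent)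
    then show ?thesis by (simp only: lookup_add sum.distrib card_eq_sum)
  qed
  show ?case
    using insert.prems
  \<comment> \<open>The outer induction removes the variable x_j; this inner one lowers the degree
    with the variables fixed.\<close>
  proof (induction d arbitrary: p rule: less_induct)
    case (less d)
    obtain q where q: "q \<in> symmetric_polys J" "Var j dvd p - q"
        "Poly_Mapping.keys q \<subseteq> Poly_Mapping.keys p"
      using symmetric_polys_restrict[OF less.prems(1), of j] J by metis
    have "elem_sym_poly J d q"
    proof (rule insert.IH[OF q(1)])
      fix m assume "m \<in> Poly_Mapping.keys q"
      then have "(\<Sum>i\<in>?I. Poly_Mapping.lookup m i) \<le> d"
        using q(3) less.prems(2) by blast
      with insert.hyps show "(\<Sum>i\<in>J. Poly_Mapping.lookup m i) \<le> d" by simp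
    qed
    then obtain Q where Q: "elem_sym_poly ?I d Q" "Var j dvd Q - q"
      using elem_sym_poly_lift[of ?I j d q] fin J by auto
    have sym: "p - Q \<in> symmetric_polys ?I"
      using less.prems(1) elem_sym_poly_symmetric[OF Q(1) fin] by (rule symmetric_polys_diff)
    have "Var j dvd p - Q"
      using dvd_diff[OF q(2) Q(2)] by simp
    then obtain r where r: "r \<in> symmetric_polys ?I" "p - Q = (\<Prod>i\<in>?I. Var i) * r"
        "\<And>m. m \<in> Poly_Mapping.keys r \<Longrightarrow> ?M + m \<in> Poly_Mapping.keys (p - Q)"
      using symmetric_polys_divide[OF sym fin symmetric_polys_Var_dvd[OF sym fin]] by blast
    have deg_r: "card ?I + (\<Sum>i\<in>?I. Poly_Mapping.lookup m i) \<le> d"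
      if "m \<in> Poly_Mapping.keys r" for m
    proof -
      have "?M + m \<in> Poly_Mapping.keys p \<union> Poly_Mapping.keys Q"
        using r(3)[OF that] by (rule subsetD[OF keys_diff])
      then have "(\<Sum>i\<in>?I. Poly_Mapping.lookup (?M + m) i) \<le> d"
        using less.prems(2) elem_sym_poly_degree[OF Q(1) fin] by blast
      then show ?thesis
        by (simp only: deg_M)
    qed
    show ?case
    proof (cases "r = 0")
      case True
      with r(2) Q(1) show ?thesis by simp
    next
      case False
      \<comment> \<open>A monomial of \<open>r\<close> witnesses \<open>card ?I \<le> d\<close>, so
        the truncated difference \<open>d - card ?I\<close> is genuine and multiplying by the top
        elementary symmetric polynomial restores the weight \<open>d\<close>.\<close>
      then obtain m where "m \<in> Poly_Mapping.keys r"
        by (metis equals0I keys_eq_empty)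
      with deg_r have d: "card ?I \<le> d" by fastforce
      moreover have "0 < card ?I"
        using fin by (simp add: card_gt_0_iff)
      ultimately have "d - card ?I < d" by simp
      then have "elem_sym_poly ?I (d - card ?I) r"
        using r(1) by (rule less.IH) (use deg_r in fastforce)
      then have "elem_sym_poly ?I (d - card ?I + card ?I) (r * elem_sym ?I (card ?I))"
        by (rule elem_sym_poly.mult)
      then have "elem_sym_poly ?I d (Q + r * elem_sym ?I (card ?I))"
        using d Q(1) by (simp add: elem_sym_poly.add)
      also have "Q + r * elem_sym ?I (card ?I) = p"
        unfolding elem_sym_card[OF fin] using r(2) by (simp add: algebra_simps)
      finally show ?thesis .
    qed
  qed
qed

text \<open>The generation half of the fundamental theorem as an induction rule, with the degree
  bookkeeping hidden. The index \<open>k\<close> is arbitrary, so uses must also treat values above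
  \<open>card I\<close>.\<close>

theorem symmetric_polys_induct [consumes 2, case_names Const add mult]:
  assumes "finite I" "p \<in> symmetric_polys I"
    and "\<And>c. P (Const c)"
    and "\<And>p q. \<lbrakk>p \<in> symmetric_polys I; q \<in> symmetric_polys I; P p; P q\<rbrakk> \<Longrightarrow> P (p + q)"
    and "\<And>p k. \<lbrakk>p \<in> symmetric_polys I; P p\<rbrakk> \<Longrightarrow> P (p * elem_sym I k)"
  shows "P p"
proof -
  \<comment> \<open>Any common degree bound will do; the sum of all degrees avoids a maximum over a
    possibly empty set.\<close>
  define d where "d = (\<Sum>m\<in>Poly_Mapping.keys p. \<Sum>i\<in>I. Poly_Mapping.lookup m i)"
  have "(\<Sum>i\<in>I. Poly_Mapping.lookup m i) \<le> d" if "m \<in> Poly_Mapping.keys p" for m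
    unfolding d_def by (rule member_le_sum) (use that in auto)
  with assms(1,2) have "elem_sym_poly I d p"
    by (rule elem_sym_poly_if_symmetric)
  then show ?thesis
    by induction (use assms elem_sym_poly_symmetric in blast)+
qed

section \<open>Tensor products of polynomial algebras\<close>

text \<open>The product of \<open>formal_tensors\<close> for two polynomial algebras, stated without
  carriers so that its laws hold on the whole type.\<close>

definition tensor_mult ::
  "(cpoly \<times> cpoly \<Rightarrow>\<^sub>0 complex) \<Rightarrow> (cpoly \<times> cpoly \<Rightarrow>\<^sub>0 complex) \<Rightarrow> (cpoly \<times> cpoly \<Rightarrow>\<^sub>0 complex)" where
  "tensor_mult f g = (\<Sum>u\<in>Poly_Mapping.keys f. \<Sum>v\<in>Poly_Mapping.keys g.
     Poly_Mapping.single (fst u * fst v, snd u * snd v)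
       (Poly_Mapping.lookup f u * Poly_Mapping.lookup g v))"

text \<open>The linear extension of the multiplication map sending (a, b) to a b; it will induce the
  isomorphism.\<close>

definition tensor_eval :: "(cpoly \<times> cpoly \<Rightarrow>\<^sub>0 complex) \<Rightarrow> cpoly" where
  "tensor_eval f = (\<Sum>u\<in>Poly_Mapping.keys f. Const (Poly_Mapping.lookup f u) * (fst u * snd u))"

lemma formal_tensors_simps:
  "carrier (formal_tensors (poly_algebra A) (poly_algebra B)) = {f. Poly_Mapping.keys f \<subseteq> A \<times> B}"
  "monoid.mult (formal_tensors (poly_algebra A) (poly_algebra B)) = tensor_mult"
  "one (formal_tensors (poly_algebra A) (poly_algebra B)) = Poly_Mapping.single (1, 1) 1"
  "zero (formal_tensors (poly_algebra A) (poly_algebra B)) = 0"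
  "add (formal_tensors (poly_algebra A) (poly_algebra B)) = (+)"
  by (simp_all add: formal_tensors_def poly_algebra_def tensor_mult_def fun_eq_iff)

text \<open>Additivity needs sums over a common index set, because the keys of \<open>f + g\<close>
  may be fewer than those of \<open>f\<close> and \<open>g\<close> together.\<close>

lemma tensor_mult_supset:
  assumes "finite U" "finite V" "Poly_Mapping.keys f \<subseteq> U" "Poly_Mapping.keys g \<subseteq> V"
  shows "tensor_mult f g = (\<Sum>u\<in>U. \<Sum>v\<in>V. Poly_Mapping.single (fst u * fst v, snd u * snd v)
     (Poly_Mapping.lookup f u * Poly_Mapping.lookup g v))"
proof -
  have "tensor_mult f g = (\<Sum>u\<in>Poly_Mapping.keys f. \<Sum>v\<in>V.
      Poly_Mapping.single (fst u * fst v, snd u * snd v)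
        (Poly_Mapping.lookup f u * Poly_Mapping.lookup g v))"
    unfolding tensor_mult_def using assms
    by (intro sum.cong refl sum.mono_neutral_left) (auto simp: in_keys_iff)
  also have "\<dots> = (\<Sum>u\<in>U. \<Sum>v\<in>V. Poly_Mapping.single (fst u * fst v, snd u * snd v)
     (Poly_Mapping.lookup f u * Poly_Mapping.lookup g v))"
    using assms by (intro sum.mono_neutral_left) (auto simp: in_keys_iff)
  finally show ?thesis .
qed

lemma tensor_mult_add_left: "tensor_mult (f + g) h = tensor_mult f h + tensor_mult g h"
proof -
  let ?U = "Poly_Mapping.keys f \<union> Poly_Mapping.keys g"
  note * = tensor_mult_supset[of ?U "Poly_Mapping.keys h" _ h]
  show ?thesis
    using keys_add[of f g]
    by (subst (1 2 3) *)
      (auto simp: lookup_add distrib_right single_add sum.distrib)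
qed

lemma tensor_mult_add_right: "tensor_mult h (f + g) = tensor_mult h f + tensor_mult h g"
proof -
  let ?V = "Poly_Mapping.keys f \<union> Poly_Mapping.keys g"
  note * = tensor_mult_supset[of "Poly_Mapping.keys h" ?V h]
  show ?thesis
    using keys_add[of f g]
    by (subst (1 2 3) *)
      (auto simp: lookup_add distrib_left single_add sum.distrib)
qed

lemma tensor_mult_0: "tensor_mult 0 g = 0" "tensor_mult g 0 = 0"
  by (simp_all add: tensor_mult_def)

lemma tensor_mult_single:
  "tensor_mult (Poly_Mapping.single u c) (Poly_Mapping.single v d) =
    Poly_Mapping.single (fst u * fst v, snd u * snd v) (c * d)"
  by (simp add: tensor_mult_def)

lemma tensor_mult_assoc: "tensor_mult (tensor_mult f g) h = tensor_mult f (tensor_mult g h)"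
  using subset_UNIV
proof (induction f rule: poly_mapping_add_induct)
  case (single u c)
  show ?case
    using subset_UNIV
  proof (induction g rule: poly_mapping_add_induct)
    case (single v d)
    show ?case
      using subset_UNIV
      by (induction h rule: poly_mapping_add_induct)
        (simp_all add: tensor_mult_0 tensor_mult_single tensor_mult_add_right mult.assoc)
  qed (simp_all add: tensor_mult_0 tensor_mult_add_left tensor_mult_add_right)
qed (simp_all add: tensor_mult_0 tensor_mult_add_left)

lemma tensor_mult_one:
  "tensor_mult (Poly_Mapping.single (1, 1) 1) f = f" (is ?l)
  "tensor_mult f (Poly_Mapping.single (1, 1) 1) = f" (is ?r)
proof -
  show ?l using subset_UNIV
    by (induction f rule: poly_mapping_add_induct)
      (simp_all add: tensor_mult_0 tensor_mult_single tensor_mult_add_right)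
  show ?r using subset_UNIV
    by (induction f rule: poly_mapping_add_induct)
      (simp_all add: tensor_mult_0 tensor_mult_single tensor_mult_add_left)
qed

lemma tensor_eval_supset:
  assumes "finite U" "Poly_Mapping.keys f \<subseteq> U"
  shows "tensor_eval f = (\<Sum>u\<in>U. Const (Poly_Mapping.lookup f u) * (fst u * snd u))"
  unfolding tensor_eval_def
  using assms by (intro sum.mono_neutral_left) (auto simp: in_keys_iff Const_simps)

lemma tensor_eval_add: "tensor_eval (f + g) = tensor_eval f + tensor_eval g"
proof -
  let ?U = "Poly_Mapping.keys f \<union> Poly_Mapping.keys g"
  show ?thesis
    using keys_add[of f g]
    by (subst (1 2 3) tensor_eval_supset[of ?U])
      (auto simp: lookup_add sum.distrib algebra_simps simp flip: Const_simps)
qed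

lemma tensor_eval_single: "tensor_eval (Poly_Mapping.single (a, b) c) = Const c * (a * b)"
  by (simp add: tensor_eval_def Const_simps)

lemma tensor_eval_0: "tensor_eval 0 = 0"
  by (simp add: tensor_eval_def)

lemma tensor_eval_uminus: "tensor_eval (- f) = - tensor_eval f"
  using tensor_eval_add[of f "- f"] by (simp add: tensor_eval_0 eq_neg_iff_add_eq_0 add.commute)

lemma tensor_eval_diff: "tensor_eval (f - g) = tensor_eval f - tensor_eval g"
  using tensor_eval_add[of f "- g"] by (simp add: tensor_eval_uminus)

lemma tensor_eval_sum: "tensor_eval (\<Sum>x\<in>X. f x) = (\<Sum>x\<in>X. tensor_eval (f x))"
  by (induction X rule: infinite_finite_induct) (simp_all add: tensor_eval_0 tensor_eval_add)

text \<open>By biadditivity it suffices to compare single tensors, where commutativity gives (a a')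
  (b b') = (a b) (a' b').\<close>

lemma tensor_eval_mult: "tensor_eval (tensor_mult f g) = tensor_eval f * tensor_eval g"
  using subset_UNIV
proof (induction f rule: poly_mapping_add_induct)
  case (single u c)
  show ?case
    using subset_UNIV
  proof (induction g rule: poly_mapping_add_induct)
    case (single v d)
    show ?case
      by (cases u, cases v)
        (simp add: tensor_mult_single tensor_eval_single mult_ac flip: Const_simps)
  qed (simp_all add: tensor_mult_0 tensor_eval_0 tensor_mult_add_right tensor_eval_add distrib_left)
qed (simp_all add: tensor_mult_0 tensor_eval_0 tensor_mult_add_left tensor_eval_add distrib_right)

lemma lookup_map_times:
  fixes f :: "'a \<Rightarrow>\<^sub>0 'b::mult_zero"
  shows "Poly_Mapping.lookup (Poly_Mapping.map ((*) c) f) k = c * Poly_Mapping.lookup f k"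
  by (simp add: map.rep_eq when_def)

lemma tensor_eval_map_times: "tensor_eval (Poly_Mapping.map ((*) c) f) = Const c * tensor_eval f"
proof -
  have "Poly_Mapping.keys (Poly_Mapping.map ((*) c) f) \<subseteq> Poly_Mapping.keys f"
    by (auto simp: in_keys_iff lookup_map_times)
  then show ?thesis
    by (subst tensor_eval_supset[of "Poly_Mapping.keys f"])
      (auto simp: tensor_eval_def lookup_map_times sum_distrib_left mult.assoc simp flip: Const_simps)
qed

section \<open>Subalgebras of the polynomial ring and the ring of formal tensors\<close>

lemma poly_subalgebra_closed:
  assumes "poly_subalgebra A"
  shows "Const c \<in> A" "0 \<in> A" "1 \<in> A" "p \<in> A \<Longrightarrow> q \<in> A \<Longrightarrow> p + q \<in> A"
    "p \<in> A \<Longrightarrow> q \<in> A \<Longrightarrow> p * q \<in> A"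
  using assms unfolding poly_subalgebra_def
  by (auto simp: image_subset_iff simp flip: Const_simps(1,2))

lemma poly_subalgebra_sum:
  assumes "poly_subalgebra A" "\<And>x. x \<in> X \<Longrightarrow> f x \<in> A"
  shows "sum f X \<in> A"
  using assms(2)
  by (induction X rule: infinite_finite_induct) (auto intro: poly_subalgebra_closed[OF assms(1)])

lemma poly_subalgebra_power:
  assumes "poly_subalgebra A" "p \<in> A"
  shows "p ^ n \<in> A"
  using assms(2) by (induction n) (auto intro: poly_subalgebra_closed[OF assms(1)])

lemma poly_subalgebra_hull: "poly_subalgebra (poly_subalgebra hull X)"
  by (rule hull_in) (auto simp: poly_subalgebra_def)

lemma keys_tensor_mult:
  assumes "poly_subalgebra A" "poly_subalgebra B"
    "Poly_Mapping.keys f \<subseteq> A \<times> B" "Poly_Mapping.keys g \<subseteq> A \<times> B"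
  shows "Poly_Mapping.keys (tensor_mult f g) \<subseteq> A \<times> B"
proof
  fix w assume "w \<in> Poly_Mapping.keys (tensor_mult f g)"
  then obtain u v where "u \<in> Poly_Mapping.keys f" "v \<in> Poly_Mapping.keys g"
      "w \<in> Poly_Mapping.keys (Poly_Mapping.single (fst u * fst v, snd u * snd v)
        (Poly_Mapping.lookup f u * Poly_Mapping.lookup g v))"
    unfolding tensor_mult_def by (blast dest: subsetD[OF keys_sum])
  moreover from this have "w = (fst u * fst v, snd u * snd v)"
    by (simp split: if_splits)
  ultimately show "w \<in> A \<times> B"
    using assms by (auto simp: mem_Times_iff poly_subalgebra_closed(5) dest!: subsetD)
qed

lemma ring_formal_tensors:
  assumes "poly_subalgebra A" "poly_subalgebra B"
  shows "ring (formal_tensors (poly_algebra A) (poly_algebra B))"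
proof (rule ringI)
  show "abelian_group (formal_tensors (poly_algebra A) (poly_algebra B))"
  proof (rule abelian_groupI, goal_cases)
    case (6 x)
    then show ?case
      by (intro bexI[of _ "- x"]) (simp_all add: formal_tensors_simps)
  qed (auto simp: formal_tensors_simps ac_simps dest!: subsetD[OF keys_add])
  show "monoid (formal_tensors (poly_algebra A) (poly_algebra B))"
    using keys_tensor_mult[OF assms] assms
    by (intro monoidI)
      (auto simp: formal_tensors_simps tensor_mult_assoc tensor_mult_one poly_subalgebra_closed)
qed (simp_all add: formal_tensors_simps tensor_mult_add_left tensor_mult_add_right)

text \<open>Values at \<open>e\<close> of polynomials with constant coefficients form a subalgebra
  containing \<open>e\<close>. The coefficients lie in \<open>range Const\<close> rather than in the
  complex numbers so that \<open>poly\<close> can be evaluated at \<open>e\<close>.\<close>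

lemma hull_singleton_poly:
  assumes "b \<in> poly_subalgebra hull {e}"
  obtains p where "\<And>i. coeff p i \<in> range Const" "b = poly p e"
proof -
  have RC: "poly_subalgebra (range Const)"
    by (auto simp: poly_subalgebra_def Const_simps)
  let ?T = "{b. \<exists>p. (\<forall>i. coeff p i \<in> range Const) \<and> b = poly p e}"
  have "poly_subalgebra ?T"
    unfolding poly_subalgebra_def
  proof (intro conjI ballI subsetI)
    fix x assume "x \<in> range Const"
    then show "x \<in> ?T"
      by (intro CollectI exI[of _ "[:x:]"])
        (auto simp: coeff_pCons poly_subalgebra_closed[OF RC] split: nat.split)
  next
    fix x y assume "x \<in> ?T" "y \<in> ?T"
    then obtain p q where p: "\<forall>i. coeff p i \<in> range Const" "x = poly p e"
      and q: "\<forall>i. coeff q i \<in> range Const" "y = poly q e" by blast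
    show "x + y \<in> ?T"
      using p q by (intro CollectI exI[of _ "p + q"])
        (simp add: poly_subalgebra_closed[OF RC] del: image_iff)
    show "x * y \<in> ?T"
      using p q by (intro CollectI exI[of _ "p * q"])
        (simp add: coeff_mult poly_subalgebra_closed[OF RC] poly_subalgebra_sum[OF RC] del: image_iff)
  qed
  moreover have "e \<in> ?T"
    by (intro CollectI exI[of _ "[:0, 1:]"])
      (auto simp: coeff_pCons poly_subalgebra_closed[OF RC] split: nat.split)
  ultimately have "poly_subalgebra hull {e} \<subseteq> ?T"
    by (intro hull_minimal) auto
  with assms that show thesis by blast
qed

text \<open>
  Modulo the bilinearity relations every formal tensor is a sum of tensors \<open>(a\<^sub>i, e\<^sup>i)\<close>, so by
  independence of the powers of \<open>e\<close> these relations generate the kernel of \<open>tensor_eval\<close>.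
\<close>

theorem tensor_product_poly_extension:
  assumes A: "poly_subalgebra A" and S: "poly_subalgebra S" and sub: "A \<subseteq> S" "e \<in> S"
    and surj: "\<And>x. x \<in> S \<Longrightarrow> \<exists>p. (\<forall>i. coeff p i \<in> A) \<and> x = poly p e"
    and indep: "\<And>p. \<lbrakk>\<And>i. coeff p i \<in> A; poly p e = 0\<rbrakk> \<Longrightarrow> p = 0"
  shows "poly_algebra S \<cong>\<^sub>a\<^sub>l\<^sub>g poly_algebra A \<otimes>\<^sub>a\<^sub>l\<^sub>g algebra_generated_by e"
proof -
  define B where "B = poly_subalgebra hull {e}"
  have B: "poly_subalgebra B"
    unfolding B_def by (rule poly_subalgebra_hull)
  have e_B: "e \<in> B"
    unfolding B_def by (rule hull_inc) simp
  have B_S: "B \<subseteq> S"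
    unfolding B_def using sub(2) S by (intro hull_minimal) auto
  note [simp] = poly_subalgebra_closed[OF A] poly_subalgebra_closed[OF B]
    poly_subalgebra_power[OF B e_B]
  define F where "F = formal_tensors (poly_algebra A) (poly_algebra B)"
  note F_simps = formal_tensors_simps[of A B, folded F_def]
  define R where "R = bilinearity_relations (poly_algebra A) (poly_algebra B)"
  define I where "I = Idl\<^bsub>F\<^esub> R"
  interpret F: ring F
    unfolding F_def using A B by (rule ring_formal_tensors)
  have R_eval: "tensor_eval f = 0" if "f \<in> R" for f
    using that unfolding R_def bilinearity_relations_def poly_algebra_def
    by (auto simp: tensor_eval_diff tensor_eval_single Const_simps distrib_left distrib_right
        mult.left_commute mult.assoc)
  have R_F: "R \<subseteq> carrier F"
    unfolding R_def bilinearity_relations_def poly_algebra_def F_simps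
    by (auto dest!: subsetD[OF keys_diff] split: if_splits)
  interpret I: ideal I F
    unfolding I_def using R_F by (rule F.genideal_ideal)
  have R_I: "R \<subseteq> I"
    unfolding I_def using R_F by (rule F.genideal_self)
  have I_0: "0 \<in> I"
    using I.zero_closed by (simp add: F_simps)
  have I_add: "f + g \<in> I" if "f \<in> I" "g \<in> I" for f g
    using I.a_closed[OF that] by (simp add: F_simps)
  have uminus_F: "\<ominus>\<^bsub>F\<^esub> f = - f" if "f \<in> carrier F" for f
    using that by (intro F.minus_equality) (auto simp: F_simps)
  have I_uminus: "- f \<in> I" if "f \<in> I" for f
    using I.a_inv_closed[OF that] uminus_F[OF I.a_Hcarr[OF that]] by simp

  \<comment> \<open>Calculating with this congruence avoids handling cosets until the very
    end.\<close>
  define eqv where "eqv f g \<longleftrightarrow> f - g \<in> I" for f g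
  have eqv_refl: "eqv f f" for f
    by (simp add: eqv_def I_0)
  have eqv_sym: "eqv g f" if "eqv f g" for f g
    using I_uminus[of "f - g"] that by (simp add: eqv_def)
  have eqv_trans [trans]: "eqv f h" if "eqv f g" "eqv g h" for f g h
    using I_add[of "f - g" "g - h"] that by (simp add: eqv_def)
  have eqv_add: "eqv (f + f') (g + g')" if "eqv f g" "eqv f' g'" for f f' g g'
    using I_add[of "f - g" "f' - g'"] that by (simp add: eqv_def algebra_simps)
  have eqv_sum: "eqv (\<Sum>x\<in>X. f x) (\<Sum>x\<in>X. g x)" if "\<And>x. x \<in> X \<Longrightarrow> eqv (f x) (g x)"
    for X :: "nat set" and f g
    using that by (induction X rule: infinite_finite_induct) (auto simp: eqv_refl intro: eqv_add)

  have rel_add_right: "eqv (Poly_Mapping.single (a, b + b') 1)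
      (Poly_Mapping.single (a, b) 1 + Poly_Mapping.single (a, b') 1)"
    if "a \<in> A" "b \<in> B" "b' \<in> B" for a b b'
  proof -
    have "Poly_Mapping.single (a, b + b') 1 - Poly_Mapping.single (a, b) 1
        - Poly_Mapping.single (a, b') 1 \<in> R"
      using that unfolding R_def bilinearity_relations_def poly_algebra_def by fastforce
    with R_I show ?thesis
      by (auto simp: eqv_def diff_diff_eq)
  qed
  have rel_add_left: "eqv (Poly_Mapping.single (a + a', b) 1)
      (Poly_Mapping.single (a, b) 1 + Poly_Mapping.single (a', b) 1)"
    if "a \<in> A" "a' \<in> A" "b \<in> B" for a a' b
  proof -
    have "Poly_Mapping.single (a + a', b) 1 - Poly_Mapping.single (a, b) 1
        - Poly_Mapping.single (a', b) 1 \<in> R"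
      using that unfolding R_def bilinearity_relations_def poly_algebra_def by fastforce
    with R_I show ?thesis
      by (auto simp: eqv_def diff_diff_eq)
  qed
  have rel_scale_left: "eqv (Poly_Mapping.single (Const c * a, b) 1) (Poly_Mapping.single (a, b) c)"
    if "a \<in> A" "b \<in> B" for c a b
  proof -
    have "Poly_Mapping.single (Const c * a, b) 1 - Poly_Mapping.single (a, b) c \<in> R"
      using that unfolding R_def bilinearity_relations_def poly_algebra_def by fastforce
    with R_I show ?thesis
      by (auto simp: eqv_def)
  qed
  have rel_scale_right: "eqv (Poly_Mapping.single (a, Const c * b) 1) (Poly_Mapping.single (a, b) c)"
    if "a \<in> A" "b \<in> B" for c a b
  proof -
    have "Poly_Mapping.single (a, Const c * b) 1 - Poly_Mapping.single (a, b) c \<in> R"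
      using that unfolding R_def bilinearity_relations_def poly_algebra_def by fastforce
    with R_I show ?thesis
      by (auto simp: eqv_def)
  qed
  \<comment> \<open>The scaling relation with scalar 0: the basis vector of (0, b) is not itself
    zero, only congruent to it.\<close>
  have single_0_left: "eqv (Poly_Mapping.single (0, b) 1) 0" if "b \<in> B" for b
    using rel_scale_left[of 0 b 0] that by (simp add: Const_simps)
  have single_0_right: "eqv (Poly_Mapping.single (a, 0) 1) 0" if "a \<in> A" for a
    using rel_scale_right[of a 0 0] that by (simp add: Const_simps)
  have single_sum_right: "eqv (Poly_Mapping.single (a, \<Sum>i\<in>X. b i) 1)
      (\<Sum>i\<in>X. Poly_Mapping.single (a, b i) 1)"
    if "a \<in> A" "\<And>i. b i \<in> B" for a b and X :: "nat set"
  proof (induction X rule: infinite_finite_induct)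
    case (insert x X)
    have "eqv (Poly_Mapping.single (a, b x + (\<Sum>i\<in>X. b i)) 1)
        (Poly_Mapping.single (a, b x) 1 + Poly_Mapping.single (a, \<Sum>i\<in>X. b i) 1)"
      using that by (intro rel_add_right poly_subalgebra_sum[OF B])
    also have "eqv \<dots> (Poly_Mapping.single (a, b x) 1 + (\<Sum>i\<in>X. Poly_Mapping.single (a, b i) 1))"
      by (intro eqv_add eqv_refl insert.IH)
    finally show ?case using insert.hyps by simp
  qed (use single_0_right that in simp_all)

  \<comment> \<open>The normal form of a tensor: the coefficient of the i-th power goes into the
    first factor, the power of \<open>e\<close> into the second.\<close>
  define tens :: "cpoly poly \<Rightarrow> (cpoly \<times> cpoly \<Rightarrow>\<^sub>0 complex)"
    where "tens p = (\<Sum>i\<le>degree p. Poly_Mapping.single (coeff p i, e ^ i) 1)" for p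
  have tens_bound: "eqv (tens p) (\<Sum>i\<le>n. Poly_Mapping.single (coeff p i, e ^ i) 1)"
    if "degree p \<le> n" for p n
  proof -
    have "tens p = (\<Sum>i\<le>n. if i \<le> degree p then Poly_Mapping.single (coeff p i, e ^ i) 1 else 0)"
      unfolding tens_def using that by (intro sum.mono_neutral_cong_left) auto
    also have "eqv \<dots> (\<Sum>i\<le>n. Poly_Mapping.single (coeff p i, e ^ i) 1)"
      by (intro eqv_sum) (auto simp: eqv_refl coeff_eq_0 intro!: eqv_sym[OF single_0_left])
    finally show ?thesis .
  qed
  have tens_add: "eqv (tens p + tens q) (tens (p + q))"
    if "\<And>i. coeff p i \<in> A" "\<And>i. coeff q i \<in> A" for p q
  proof -
    \<comment> \<open>Both normal forms are padded with zero coefficients to a common length before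
      being added termwise.\<close>
    define n where "n = max (degree p) (degree q)"
    let ?t = "\<lambda>p. \<Sum>i\<le>n. Poly_Mapping.single (coeff p i, e ^ i) 1"
    have "eqv (tens p + tens q) (?t p + ?t q)"
      by (intro eqv_add tens_bound) (simp_all add: n_def)
    also have "eqv (?t p + ?t q) (?t (p + q))"
      unfolding sum.distrib[symmetric] coeff_add
      by (intro eqv_sum eqv_sym[OF rel_add_left]) (simp_all add: that)
    also have "eqv (?t (p + q)) (tens (p + q))"
      by (intro eqv_sym[OF tens_bound]) (simp add: n_def degree_add_le_max)
    finally show ?thesis .
  qed
  have tens_single: "\<exists>p. (\<forall>i. coeff p i \<in> A) \<and> eqv (Poly_Mapping.single (a, b) c) (tens p)"
    if "a \<in> A" "b \<in> B" for a b c
  proof -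
    obtain q where q: "\<And>i. coeff q i \<in> range Const" "b = poly q e"
      using \<open>b \<in> B\<close> hull_singleton_poly unfolding B_def by metis
    have q_A: "coeff q i \<in> A" and q_B: "coeff q i \<in> B" for i
      using q(1)[of i] by auto
    \<comment> \<open>The scalar \<open>c\<close> is absorbed into the first factor; then the
      constant coefficients of \<open>q\<close> are moved across the tensor sign.\<close>
    let ?a = "Const c * a"
    have a: "?a \<in> A" using that by simp
    have "eqv (Poly_Mapping.single (a, b) c) (Poly_Mapping.single (?a, b) 1)"
      using that by (intro eqv_sym[OF rel_scale_left])
    also have "eqv \<dots> (\<Sum>i\<le>degree q. Poly_Mapping.single (?a, coeff q i * e ^ i) 1)"
      unfolding q(2) poly_altdef using a q_B by (intro single_sum_right) simp_all
    also have "eqv \<dots> (\<Sum>i\<le>degree q. Poly_Mapping.single (coeff (smult ?a q) i, e ^ i) 1)"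
    proof (rule eqv_sum)
      fix i
      obtain z where z: "coeff q i = Const z" using q(1)[of i] by auto
      have "eqv (Poly_Mapping.single (?a, Const z * e ^ i) 1) (Poly_Mapping.single (?a, e ^ i) z)"
        using a by (intro rel_scale_right) simp_all
      also have "eqv \<dots> (Poly_Mapping.single (Const z * ?a, e ^ i) 1)"
        using a by (intro eqv_sym[OF rel_scale_left]) simp_all
      finally show "eqv (Poly_Mapping.single (?a, coeff q i * e ^ i) 1)
          (Poly_Mapping.single (coeff (smult ?a q) i, e ^ i) 1)"
        by (simp add: z mult.commute)
    qed
    also have "eqv \<dots> (tens (smult ?a q))"
      by (intro eqv_sym[OF tens_bound]) (rule degree_smult_le)
    finally show ?thesis
      using a q_A by (intro exI[of _ "smult ?a q"]) (simp add: \<open>a \<in> A\<close>)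
  qed
  have tens_eqv: "\<exists>p. (\<forall>i. coeff p i \<in> A) \<and> eqv f (tens p)" if "f \<in> carrier F" for f
    using that unfolding F_simps mem_Collect_eq
  proof (induction f rule: poly_mapping_add_induct)
    case zero
    show ?case
      by (intro exI[of _ 0]) (auto simp: tens_def intro: eqv_sym[OF single_0_left])
  next
    case (single u c)
    then show ?case using tens_single by (cases u) auto
  next
    case (add f g)
    then obtain p q where "\<forall>i. coeff p i \<in> A" "eqv f (tens p)" "\<forall>i. coeff q i \<in> A" "eqv g (tens q)"
      by blast
    then show ?case
      by (intro exI[of _ "p + q"]) (auto intro: eqv_trans[OF eqv_add tens_add])
  qed
  have tens_eval: "tensor_eval (tens p) = poly p e" for p
    by (simp add: tens_def tensor_eval_sum tensor_eval_single Const_simps poly_altdef)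
  have tens_F: "tens p \<in> carrier F" if "\<And>i. coeff p i \<in> A" for p
    unfolding F_simps tens_def using that by (auto dest!: subsetD[OF keys_sum])

  have I_eval: "tensor_eval f = 0" if "f \<in> I" for f
  proof -
    \<comment> \<open>The kernel of evaluation is an ideal containing the relations, hence contains
      the ideal they generate.\<close>
    let ?K = "{f \<in> carrier F. tensor_eval f = 0}"
    have "subgroup ?K (add_monoid F)"
    proof (rule subgroup.intro)
      fix x assume x: "x \<in> ?K"
      then have "inv\<^bsub>add_monoid F\<^esub> x = - x"
        using uminus_F[of x] by (simp add: a_inv_def)
      with x show "inv\<^bsub>add_monoid F\<^esub> x \<in> ?K"
        by (simp add: tensor_eval_uminus) (simp add: F_simps)
    qed (auto simp: F_simps tensor_eval_add tensor_eval_0 dest!: subsetD[OF keys_add])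
    then have "ideal ?K F"
      using F.m_closed by (intro idealI F.ring_axioms) (auto simp: F_simps tensor_eval_mult)
    moreover have "R \<subseteq> ?K"
      using R_F R_eval by blast
    ultimately have "I \<subseteq> ?K"
      unfolding I_def by (rule F.genideal_minimal)
    with that show ?thesis by blast
  qed
  have I_iff: "f \<in> I \<longleftrightarrow> tensor_eval f = 0" if f_F: "f \<in> carrier F" for f
  proof
    \<comment> \<open>Evaluating the normal form of \<open>f\<close> gives a relation among the
      powers of \<open>e\<close>, so independence forces the normal form to be that of 0.\<close>
    assume f: "tensor_eval f = 0"
    obtain p where p: "\<forall>i. coeff p i \<in> A" "eqv f (tens p)"
      using tens_eqv[OF f_F] by blast
    then have "poly p e = 0"
      using I_eval[of "f - tens p"] by (simp add: eqv_def f tensor_eval_diff tens_eval)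
    with p(1) have "p = 0"
      by (intro indep) auto
    \<comment> \<open>Since \<open>degree 0 = 0\<close>, the sum \<open>tens 0\<close> still has the
      term at index 0 and is not literally 0.\<close>
    with p(2) have "eqv f (Poly_Mapping.single (0, 1) 1)"
      by (simp add: tens_def)
    also have "eqv \<dots> 0"
      by (rule single_0_left) simp
    finally show "f \<in> I" by (simp add: eqv_def)
  qed (rule I_eval)

  \<comment> \<open>The fibres of \<open>tensor_eval\<close> over \<open>S\<close> are exactly the
    cosets of \<open>I\<close>, so \<open>h\<close> is the inverse of the map induced on the
    quotient.\<close>
  define h where "h x = {f \<in> carrier F. tensor_eval f = x}" for x
  have h_coset: "I +>\<^bsub>F\<^esub> f = h (tensor_eval f)" if f: "f \<in> carrier F" for f
  proof (intro equalityI subsetI)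
    fix g assume "g \<in> I +>\<^bsub>F\<^esub> f"
    then obtain k where k: "k \<in> I" "g = k + f"
      by (auto simp: a_r_coset_def' F_simps)
    with f show "g \<in> h (tensor_eval f)"
      using F.a_closed[OF I.a_Hcarr[OF k(1)] f] I_eval[OF k(1)]
      by (simp add: h_def tensor_eval_add F_simps(5))
  next
    fix g assume g: "g \<in> h (tensor_eval f)"
    then have "g - f \<in> carrier F"
      using f by (auto simp: h_def F_simps dest!: subsetD[OF keys_diff])
    then have "g - f \<in> I"
      using g by (simp add: I_iff h_def tensor_eval_diff)
    then show "g \<in> I +>\<^bsub>F\<^esub> f"
      by (auto simp: a_r_coset_def' F_simps(5) intro!: bexI[of _ "g - f"])
  qed
  have h_ex: "\<exists>f \<in> carrier F. tensor_eval f = x" if "x \<in> S" for x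
    using surj[OF that] tens_eval tens_F by metis
  have eval_S: "tensor_eval f \<in> S" if "f \<in> carrier F" for f
    unfolding tensor_eval_def using that sub(1) B_S
    by (intro poly_subalgebra_sum[OF S] poly_subalgebra_closed[OF S]) (auto simp: F_simps)

  define T where "T = poly_algebra A \<otimes>\<^sub>a\<^sub>l\<^sub>g algebra_generated_by e"
  have T: "carrier T = a_rcosets\<^bsub>F\<^esub> I" "monoid.mult T = rcoset_mult F I"
      "one T = I +>\<^bsub>F\<^esub> one F" "add T = set_add F"
      "module.smult T = (\<lambda>c X. \<Union>f\<in>X. I +>\<^bsub>F\<^esub> Poly_Mapping.map ((*) c) f)"
    unfolding T_def algebra_direct_product_def algebra_generated_by_def Let_def
    by (simp_all add: FactRing_def flip: B_def F_def R_def I_def)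
  have T_carrier: "carrier T = h ` S"
  proof -
    have "S = tensor_eval ` carrier F"
      using h_ex eval_S by blast
    then show ?thesis
      by (auto simp: T(1) A_RCOSETS_def' h_coset)
  qed
  have "h \<in> ring_hom (poly_algebra S) T"
  proof (rule ring_hom_memI)
    fix x y assume "x \<in> carrier (poly_algebra S)" "y \<in> carrier (poly_algebra S)"
    then obtain f g where f: "f \<in> carrier F" "tensor_eval f = x"
      and g: "g \<in> carrier F" "tensor_eval g = y"
      using h_ex unfolding poly_algebra_def by auto metis
    show "h (x \<otimes>\<^bsub>poly_algebra S\<^esub> y) = h x \<otimes>\<^bsub>T\<^esub> h y"
      using I.rcoset_mult_add[OF f(1) g(1)] f g F.m_closed[OF f(1) g(1)]
      by (simp add: T h_coset poly_algebra_def) (simp add: F_simps tensor_eval_mult)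
    show "h (x \<oplus>\<^bsub>poly_algebra S\<^esub> y) = h x \<oplus>\<^bsub>T\<^esub> h y"
      using I.a_rcos_sum[OF f(1) g(1)] f g F.a_closed[OF f(1) g(1)]
      by (simp add: T h_coset poly_algebra_def) (simp add: F_simps tensor_eval_add)
  next
    show "h \<one>\<^bsub>poly_algebra S\<^esub> = \<one>\<^bsub>T\<^esub>"
      by (simp add: T h_coset poly_algebra_def) (simp add: F_simps tensor_eval_single Const_simps)
  qed (auto simp: T_carrier poly_algebra_def)
  moreover have "h (c \<odot>\<^bsub>poly_algebra S\<^esub> x) = c \<odot>\<^bsub>T\<^esub> h x" if "x \<in> S" for c x
  proof -
    \<comment> \<open>All members of the union defining scalar multiplication are the same coset,
      and the index set \<open>h x\<close> is nonempty.\<close>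
    have "I +>\<^bsub>F\<^esub> Poly_Mapping.map ((*) c) f = h (Const c * x)" if "f \<in> h x" for f
    proof -
      have "Poly_Mapping.map ((*) c) f \<in> carrier F"
        using that by (auto simp: h_def F_simps in_keys_iff lookup_map_times)
      then show ?thesis
        using that by (simp add: h_coset tensor_eval_map_times h_def)
    qed
    moreover have "h x \<noteq> {}"
      using h_ex[OF that] by (auto simp: h_def)
    ultimately show ?thesis
      by (simp add: T poly_algebra_def)
  qed
  ultimately have "h \<in> algebra_hom (poly_algebra S) T"
    by (simp add: algebra_hom_def) (simp add: poly_algebra_def)
  moreover have "inj_on h S"
  proof (rule inj_onI)
    fix x y assume "x \<in> S" "h x = h y"
    then show "x = y"
      using h_ex[of x] unfolding h_def by blast
  qed
  then have "bij_betw h (carrier (poly_algebra S)) (carrier T)"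
    by (simp add: bij_betw_def T_carrier) (simp add: poly_algebra_def)
  ultimately show ?thesis
    unfolding algebra_isomorphic_def T_def by blast
qed

section \<open>Adjoining one variable\<close>

lemma poly_subalgebra_symmetric_polys: "poly_subalgebra (symmetric_polys I)"
  by (auto simp: poly_subalgebra_def Const_in_symmetric_polys symmetric_polys_add
      symmetric_polys_mult)

lemma sym_algebra_homD:
  assumes "\<Phi> \<in> algebra_hom (sym_algebra J) (sym_algebra I)"
  shows "p \<in> symmetric_polys J \<Longrightarrow> \<Phi> p \<in> symmetric_polys I"
    and "p \<in> symmetric_polys J \<Longrightarrow> q \<in> symmetric_polys J \<Longrightarrow> \<Phi> (p + q) = \<Phi> p + \<Phi> q"
    and "p \<in> symmetric_polys J \<Longrightarrow> q \<in> symmetric_polys J \<Longrightarrow> \<Phi> (p * q) = \<Phi> p * \<Phi> q"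
    and "\<Phi> (Const c) = Const c"
proof -
  have hom: "\<Phi> \<in> ring_hom (sym_algebra J) (sym_algebra I)"
    and smult: "\<And>c p. p \<in> symmetric_polys J \<Longrightarrow> \<Phi> (Const c * p) = Const c * \<Phi> p"
    using assms by (auto simp: algebra_hom_def sym_algebra_def poly_algebra_def)
  show "p \<in> symmetric_polys J \<Longrightarrow> \<Phi> p \<in> symmetric_polys I"
    and "p \<in> symmetric_polys J \<Longrightarrow> q \<in> symmetric_polys J \<Longrightarrow> \<Phi> (p + q) = \<Phi> p + \<Phi> q"
    and "p \<in> symmetric_polys J \<Longrightarrow> q \<in> symmetric_polys J \<Longrightarrow> \<Phi> (p * q) = \<Phi> p * \<Phi> q"
    using ring_hom_closed[OF hom, of p] ring_hom_add[OF hom, of p q] ring_hom_mult[OF hom, of p q]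
    by (simp_all add: sym_algebra_def poly_algebra_def)
  show "\<Phi> (Const c) = Const c"
    using smult[of 1 c] ring_hom_one[OF hom]
      poly_subalgebra_closed(3)[OF poly_subalgebra_symmetric_polys]
    by (simp add: sym_algebra_def poly_algebra_def)
qed

lemma poly_subalgebra_image:
  assumes "\<Phi> \<in> algebra_hom (sym_algebra J) (sym_algebra I)"
  shows "poly_subalgebra (\<Phi> ` symmetric_polys J)"
  unfolding poly_subalgebra_def
proof (intro conjI ballI)
  note hom = sym_algebra_homD[OF assms]
  show "range Const \<subseteq> \<Phi> ` symmetric_polys J"
    by (metis Const_in_symmetric_polys hom(4) image_subsetI rev_image_eqI)
  fix x y assume "x \<in> \<Phi> ` symmetric_polys J" "y \<in> \<Phi> ` symmetric_polys J"
  then obtain p q where pq: "p \<in> symmetric_polys J" "q \<in> symmetric_polys J" "x = \<Phi> p" "y = \<Phi> q"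
    by blast
  then show "x + y \<in> \<Phi> ` symmetric_polys J" "x * y \<in> \<Phi> ` symmetric_polys J"
    by (auto simp flip: hom(2,3) intro: symmetric_polys_add symmetric_polys_mult)
qed

section \<open>The decomposition for a finite set of variables with one distinguished
  variable\<close>

context
  fixes I :: "nat set" and j :: nat and \<Phi> :: "cpoly \<Rightarrow> cpoly"
  assumes fin: "finite I" and j: "j \<in> I"
    and \<Phi>: "\<Phi> \<in> algebra_hom (sym_algebra (I - {j})) (sym_algebra I)"
    and \<Phi>_elem_sym: "\<And>k. k < card I \<Longrightarrow> \<Phi> (elem_sym (I - {j}) k) = elem_sym I k"
begin

text \<open>This expresses that setting x_j = 0 is a left inverse of \<Phi>. It holds for the
  generators by the recursion and passes to sums and products.\<close>

lemma hom_cong_Var: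
  assumes "p \<in> symmetric_polys (I - {j})"
  shows "Var j dvd \<Phi> p - p"
proof -
  note hom = sym_algebra_homD[OF \<Phi>]
  have fin_J: "finite (I - {j})" using fin by simp
  show ?thesis
    using fin_J assms
  proof (induction rule: symmetric_polys_induct)
    case (Const c)
    show ?case by (simp add: hom)
  next
    case (add p q)
    then have "\<Phi> (p + q) - (p + q) = (\<Phi> p - p) + (\<Phi> q - q)"
      by (simp add: hom)
    then show ?case
      using add.IH by (metis dvd_add)
  next
    case (mult p k)
    let ?s = "elem_sym (I - {j}) k"
    have "Var j dvd \<Phi> ?s - ?s"
    proof (cases "k < card I")
      case True
      then show ?thesis using elem_sym_cong_Var[OF fin j] by (simp add: \<Phi>_elem_sym)
    next
      \<comment> \<open>Here \<open>k\<close> exceeds the number \<open>card I - 1\<close> of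
        remaining variables, so \<open>?s\<close> vanishes.\<close>
      case False
      then have "card (I - {j}) < k"
        using fin j by (metis card_Diff1_less leI order_less_le_trans)
      then have "?s = 0"
        by (rule elem_sym_eq_0[OF fin_J])
      then show ?thesis using hom(4)[of 0] by (simp add: Const_simps)
    qed
    then have "Var j dvd (\<Phi> p - p) * \<Phi> ?s + p * (\<Phi> ?s - ?s)"
      using mult.IH by (intro dvd_add dvd_mult dvd_mult2)
    also have "\<dots> = \<Phi> (p * ?s) - p * ?s"
      using mult.hyps elem_sym_in_symmetric_polys[OF fin_J] by (simp add: hom algebra_simps)
    finally show ?case .
  qed
qed

text \<open>Setting \<open>x\<^sub>j = 0\<close> in a relation \<open>\<Sum>i. \<Phi> p\<^sub>i * e\<^sup>i = 0\<close> yields \<open>p\<^sub>0 = 0\<close>; then cancel \<open>e\<close>.\<close>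

lemma poly_in_elem_sym_card_eq_0:
  assumes "\<And>i. coeff P i \<in> \<Phi> ` symmetric_polys (I - {j})" "poly P (elem_sym I (card I)) = 0"
  shows "P = 0"
  using assms
proof (induction P)
  case (pCons a P)
  let ?e = "elem_sym I (card I)"
  obtain p where p: "p \<in> symmetric_polys (I - {j})" "a = \<Phi> p"
    using pCons.prems(1)[of 0] by auto
  have P: "coeff P i \<in> \<Phi> ` symmetric_polys (I - {j})" for i
    using pCons.prems(1)[of "Suc i"] by simp
  have "Var j dvd (\<Prod>i\<in>I. Var i)"
    using fin j by (rule dvd_prodI)
  then have "Var j dvd ?e"
    by (simp add: elem_sym_card[OF fin])
  moreover have "\<Phi> p = - (?e * poly P ?e)"
    using pCons.prems(2) p(2) by (simp add: eq_neg_iff_add_eq_0)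
  ultimately have "Var j dvd \<Phi> p"
    by simp
  \<comment> \<open>This difference is \<open>p\<close> itself, which does not contain x_j.\<close>
  then have "Var j dvd \<Phi> p - (\<Phi> p - p)"
    using hom_cong_Var[OF p(1)] by (rule dvd_diff)
  then have "p = 0"
    using Var_dvd_polys_in_eq_0[of j p "I - {j}"] p(1) by (simp add: symmetric_polys_def)
  then have a: "a = 0"
    using sym_algebra_homD(4)[OF \<Phi>, of 0] p(2) by (simp add: Const_simps)
  moreover have "?e \<noteq> 0"
    unfolding elem_sym_card[OF fin] prod_Var by (metis lookup_single_eq lookup_zero zero_neq_one)
  \<comment> \<open>Cancelling \<open>?e\<close> uses that the polynomial ring has no zero
    divisors.\<close>
  ultimately have "poly P ?e = 0"
    using pCons.prems(2) by simp
  then show ?case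
    using pCons.IH P a by simp
qed simp

text \<open>Induction over the generators: \<open>elem_sym I k\<close> is in the image of \<Phi> for
  \<open>k < card I\<close>, acts as the indeterminate of \<open>P\<close> for
  \<open>k = card I\<close>, and vanishes beyond.\<close>

lemma symmetric_poly_eq_poly_elem_sym_card:
  assumes "x \<in> symmetric_polys I"
  shows "\<exists>P. (\<forall>i. coeff P i \<in> \<Phi> ` symmetric_polys (I - {j})) \<and> x = poly P (elem_sym I (card I))"
proof -
  let ?A = "\<Phi> ` symmetric_polys (I - {j})"
  note A = poly_subalgebra_closed[OF poly_subalgebra_image[OF \<Phi>]]
  show ?thesis
    using fin assms
  proof (induction rule: symmetric_polys_induct)
    case (Const c)
    show ?case
      by (intro exI[of _ "[:Const c:]"]) (simp add: coeff_pCons A split: nat.split)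
  next
    case (add x y)
    then obtain P Q where "\<forall>i. coeff P i \<in> ?A" "x = poly P (elem_sym I (card I))"
        "\<forall>i. coeff Q i \<in> ?A" "y = poly Q (elem_sym I (card I))"
      by blast
    then show ?case
      by (intro exI[of _ "P + Q"]) (simp add: A)
  next
    case (mult x k)
    then obtain P where P: "\<forall>i. coeff P i \<in> ?A" "x = poly P (elem_sym I (card I))"
      by blast
    consider "k < card I" | "k = card I" | "card I < k" by linarith
    then show ?case
    proof cases
      case 1
      have "elem_sym I k \<in> ?A"
        using \<Phi>_elem_sym[OF 1] elem_sym_in_symmetric_polys[of "I - {j}" k] fin
        by (metis finite_Diff imageI)
      with P show ?thesis
        by (intro exI[of _ "smult (elem_sym I k) P"]) (simp add: A mult.commute)
    next
      case 2
      with P show ?thesis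
        by (intro exI[of _ "pCons 0 P"]) (simp add: coeff_pCons A mult.commute split: nat.split)
    next
      case 3
      then show ?thesis
        by (intro exI[of _ 0]) (simp add: elem_sym_eq_0[OF fin] A)
    qed
  qed
qed

lemma sym_algebra_tensor_decomposition:
  "sym_algebra I \<cong>\<^sub>a\<^sub>l\<^sub>g poly_algebra (\<Phi> ` symmetric_polys (I - {j})) \<otimes>\<^sub>a\<^sub>l\<^sub>g
    algebra_generated_by (elem_sym I (card I))"
  unfolding sym_algebra_def
  using sym_algebra_homD(1)[OF \<Phi>] symmetric_poly_eq_poly_elem_sym_card poly_in_elem_sym_card_eq_0
  by (intro tensor_product_poly_extension poly_subalgebra_image[OF \<Phi>]
      poly_subalgebra_symmetric_polys elem_sym_in_symmetric_polys[OF fin]) auto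

end

theorem theorem3p6:
  fixes n j :: nat and \<Phi> :: "cpoly \<Rightarrow> cpoly"
  assumes "j \<in> {1..n+1}"
    and "\<Phi> \<in> algebra_mono (sym_algebra ({1..n+1} - {j})) (sym_algebra {1..n+1})"
    and "\<And>k. k \<in> {1..n} \<Longrightarrow>
      \<Phi> (elem_sym ({1..n+1} - {j}) k) =
        elem_sym ({1..n+1} - {j}) k + elem_sym ({1..n+1} - {j}) (k - 1) * Var j"
  shows "sym_algebra {1..n+1} \<cong>\<^sub>a\<^sub>l\<^sub>g
    poly_algebra (\<Phi> ` carrier (sym_algebra ({1..n+1} - {j}))) \<otimes>\<^sub>a\<^sub>l\<^sub>g
    algebra_generated_by (elem_sym ({1..n+1} - {j}) n * elem_sym {j} 1)"
proof -
  let ?I = "{1..n+1}"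
  let ?J = "?I - {j}"
  have fin: "finite ?I" and fin_J: "finite ?J" and card: "card ?I = n + 1" and card_J: "card ?J = n"
    using assms(1) by auto
  have \<Phi>: "\<Phi> \<in> algebra_hom (sym_algebra ?J) (sym_algebra ?I)"
    using assms(2) by (simp add: algebra_mono_def)
  \<comment> \<open>The prescribed values cover \<open>k\<close> from 1 to \<open>n\<close>; at
    \<open>k = 0\<close> both sides are 1 because \<Phi> fixes constants.\<close>
  have \<Phi>_elem_sym: "\<Phi> (elem_sym ?J k) = elem_sym ?I k" if "k < card ?I" for k
  proof (cases "k = 0")
    case True
    with sym_algebra_homD(4)[OF \<Phi>, of 1] show ?thesis
      by (simp add: elem_sym_0 Const_simps)
  next
    case False
    then have "k \<in> {1..n}" using that card by simp
    with assms(3) elem_sym_recursion[OF fin assms(1), of k] show ?thesis by simp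
  qed
  \<comment> \<open>In the recursion at \<open>n + 1\<close> the first summand vanishes, as
    \<open>?J\<close> has only \<open>n\<close> variables; the second is the given generator, which
    is thus the product of all variables.\<close>
  have "elem_sym ?J (n + 1) = 0"
    using fin_J card_J by (intro elem_sym_eq_0) simp_all
  moreover have "elem_sym {j} 1 = Var j"
    using elem_sym_card[of "{j}"] by simp
  ultimately have "elem_sym ?J n * elem_sym {j} 1 = elem_sym ?I (card ?I)"
    using elem_sym_recursion[OF fin assms(1), of "n + 1"] card by simp
  moreover have "carrier (sym_algebra ?J) = symmetric_polys ?J"
    by (simp add: sym_algebra_def poly_algebra_def)
  ultimately show ?thesis
    using sym_algebra_tensor_decomposition[OF fin assms(1) \<Phi> \<Phi>_elem_sym] by simp
qed

end
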